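(* Let $L,N\ge1$, let $U=\{u_k\}_{k=1}^N\subset\mathbb{R}$, and assume that the $L\times N$ Vandermonde matrix $\boldsymbol{V}:=\boldsymbol{V}(L,U)$ has rank $r=\min\{L,N\}$. Let $\{\delta_k\}_{k=1}^N\subset\mathbb{R}$ be such that $\ell:=\|\delta\|_\infty=\max_k|\delta_k|$ satisfies $\ell<\frac14$ and $C(\ell)<\frac{\sigma_r(\boldsymbol{V})}{\sigma_1(\boldsymbol{V})}$. Let $U'=\{u_k+\frac{\delta_k}{L}\}_{k=1}^N$. Then the $L\times N$ matrix $\boldsymbol{V}':=\boldsymbol{V}(L,U')$ has rank $r$, and its extreme singular values satisfy $$\sigma_r(\boldsymbol{V}')\ge\sigma_r(\boldsymbol{V})\left(1-\frac{\sigma_1(\boldsymbol{V})}{\sigma_r(\boldsymbol{V})}\,C(\ell)\right)\quad\text{and}\quad\sigma_1(\boldsymbol{V}')\le\sigma_1(\boldsymbol{V})\,(1+C(\ell)).$$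
   Context: For $X=\{x_k\}_{k=1}^N\subset\mathbb{R}$ (taken modulo $1$), $\boldsymbol{V}(L,X)=[e^{2\pi ijx_k}]_{0\le j<L,\,1\le k\le N}$. $\sigma_1\ge\sigma_2\ge\cdots$ are the singular values of a matrix. $C(t)=1-\cos(\pi t)+\sin(\pi t)$. *)

theory Defs
  imports
    Complex_Main
    "HOL-Computational_Algebra.Polynomial"
    "Jordan_Normal_Form.DL_Rank"
    "Jordan_Normal_Form.Schur_Decomposition"
begin

(* A family of N nodes is a function on the indices k < N.  Nodes are real representatives of
   points modulo 1; coincidences are not excluded. *)
definition vandermonde :: "nat \<Rightarrow> nat \<Rightarrow> (nat \<Rightarrow> real) \<Rightarrow> complex mat" where
  "vandermonde L N x =
     mat L N (\<lambda>(j, k). exp (2 * complex_of_real pi * \<i> * of_nat j * complex_of_real (x k)))"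

(* The singular values are the square roots of the eigenvalues of A^* A, counted with algebraic
   multiplicity and listed in decreasing order.  These eigenvalues are real and nonnegative, so
   Re only changes the type.  There are dim_col A of them, including the zeros that appear
   when dim_row A < dim_col A. *)
definition singular_values :: "complex mat \<Rightarrow> real list" where
  "singular_values A =
     rev (sorted_list_of_multiset
       (image_mset (\<lambda>z. sqrt (Re z)) (proots (char_poly (mat_adjoint A * A)))))"

(* Indexed from 1, so singular_value 1 A is the largest; meaningful for 1 <= k <= dim_col A. *)
definition singular_value :: "nat \<Rightarrow> complex mat \<Rightarrow> real" where
  "singular_value k A = singular_values A ! (k - 1)"

(* vec_space.rank takes the number of rows as a parameter. *)
abbreviation mat_rank :: "complex mat \<Rightarrow> nat" where
  "mat_rank A \<equiv> vec_space.rank (dim_row A) A"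

(* Intended for N >= 1. *)
definition sup_norm :: "nat \<Rightarrow> (nat \<Rightarrow> real) \<Rightarrow> real" where
  "sup_norm N d = Max ((\<lambda>k. \<bar>d k\<bar>) ` {..<N})"

definition kadec_C :: "real \<Rightarrow> real" where
  "kadec_C t = 1 - cos (pi * t) + sin (pi * t)"

end

theory Submission
  imports Defs "HOL-Analysis.L2_Norm"
begin

text \<open>
  The theorem is a norm estimate followed by Weyl's inequality. Write \<open>V\<close> for the matrix of
  the original nodes and \<open>V'\<close> for that of the moved nodes. If \<open>D\<close> is the diagonal unitary
  matrix with entries \<open>exp (- \<i> \<pi> \<delta>\<^sub>k)\<close>, then \<open>V' D\<close> has the singular values of
  \<open>V'\<close>, and its entries are those of \<open>V\<close> multiplied by
  \<open>exp (\<i> \<delta>\<^sub>k \<theta>\<^sub>j)\<close> with \<open>\<bar>\<theta>\<^sub>j\<bar> \<le> \<pi>\<close>.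

  The core is the bound \<open>\<parallel>(V' D - V) x\<parallel> \<le> C(l) \<sigma>\<^sub>1(V) \<parallel>x\<parallel>\<close>
  (\<open>vandermonde_perturbation\<close>). Kadec's classical argument expands
  \<open>1 - exp (\<i> \<delta> \<theta>)\<close> in a trigonometric series in \<open>\<theta>\<close>. Here it is instead
  integrated in \<open>\<delta>\<close>, in discrete form: along the sorted values of
  \<open>\<bar>\<delta>\<^sub>k\<bar>\<close> each of \<open>cos (\<bar>\<delta>\<^sub>k\<bar> \<theta>\<^sub>j) - 1\<close> and
  \<open>sin (\<bar>\<delta>\<^sub>k\<bar> \<theta>\<^sub>j)\<close> is a telescoping sum of products of a row multiplier and
  a column selection, and for values up to \<open>1/4\<close> the increments are largest at
  \<open>\<theta> = \<pi>\<close>. Hence the bounds add up to \<open>1 - cos (\<pi> l)\<close> and \<open>sin (\<pi> l)\<close>,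
  together \<open>C(l)\<close> (\<open>multiplier_bound\<close>, \<open>cos_increment_bound\<close>,
  \<open>sin_increment_bound\<close>).

  The singular values are defined through the characteristic polynomial of \<open>mat_adjoint A * A\<close>.
  They are tied to norms by unitary diagonalization (\<open>hermitian_diagonalization\<close>,
  \<open>singular_value_basis\<close>). With this, \<open>singular_value_perturbation\<close> gives
  \<open>\<bar>\<sigma>\<^sub>k(V') - \<sigma>\<^sub>k(V)\<bar> \<le> C(l) \<sigma>\<^sub>1(V)\<close> for \<open>k = 1\<close> and
  \<open>k = r\<close> alike, whichever of \<open>L\<close> and \<open>N\<close> is smaller. The hypothesis on \<open>C(l)\<close>
  then makes \<open>\<sigma>\<^sub>r(V')\<close> positive, so the rank is at least \<open>r\<close>
  (\<open>rank_ge_if_singular_value_pos\<close>), and it never exceeds \<open>min L N\<close>.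
\<close>

section \<open>Adjoints and unitary matrices\<close>

lemma mat_adjoint_carrier [simp]:
  "A \<in> carrier_mat m n \<Longrightarrow> mat_adjoint A \<in> carrier_mat n m"
  unfolding mat_adjoint_def by (auto simp: mat_of_rows_def)

lemma dim_mat_adjoint [simp]:
  "dim_row (mat_adjoint A) = dim_col A" "dim_col (mat_adjoint A) = dim_row A"
  unfolding mat_adjoint_def by (auto simp: mat_of_rows_def)

lemma index_mat_adjoint [simp]:
  "i < dim_col A \<Longrightarrow> j < dim_row A \<Longrightarrow> mat_adjoint A $$ (i, j) = conjugate (A $$ (j, i))"
  unfolding mat_adjoint_def by (simp add: mat_of_rows_index)

lemma mat_adjoint_mult:
  fixes A B :: "complex mat"
  assumes "A \<in> carrier_mat m n" "B \<in> carrier_mat n p"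
  shows "mat_adjoint (A * B) = mat_adjoint B * mat_adjoint A"
  by (rule eq_matI) (use assms in \<open>auto simp: scalar_prod_def mult.commute\<close>)

lemma mat_adjoint_adjoint [simp]: "mat_adjoint (mat_adjoint A) = (A :: complex mat)"
  by (rule eq_matI) auto

lemma mat_adjoint_one [simp]: "mat_adjoint (1\<^sub>m n :: complex mat) = 1\<^sub>m n"
  by (rule eq_matI) auto

lemma mat_adjoint_block_diag:
  fixes B D :: "complex mat"
  assumes "B \<in> carrier_mat m m" "D \<in> carrier_mat n n"
  shows "mat_adjoint (four_block_mat B (0\<^sub>m m n) (0\<^sub>m n m) D) =
    four_block_mat (mat_adjoint B) (0\<^sub>m m n) (0\<^sub>m n m) (mat_adjoint D)"
  by (rule eq_matI) (use assms in auto)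

lemma mult_carrier_square [simp]:
  "A \<in> carrier_mat n n \<Longrightarrow> B \<in> carrier_mat n n \<Longrightarrow> A * B \<in> carrier_mat n n"
  by (rule mult_carrier_mat)

lemma mult_mat_vec_carrier_square [simp]:
  "A \<in> carrier_mat n n \<Longrightarrow> x \<in> carrier_vec n \<Longrightarrow> A *\<^sub>v x \<in> carrier_vec n"
  by (rule mult_mat_vec_carrier)

lemma mult_block_diag:
  fixes B B' D D' :: "complex mat"
  assumes "B \<in> carrier_mat m m" "D \<in> carrier_mat n n" "B' \<in> carrier_mat m m" "D' \<in> carrier_mat n n"
  shows "four_block_mat B (0\<^sub>m m n) (0\<^sub>m n m) D * four_block_mat B' (0\<^sub>m m n) (0\<^sub>m n m) D' =
    four_block_mat (B * B') (0\<^sub>m m n) (0\<^sub>m n m) (D * D')"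
  using assms by (subst mult_four_block_mat[of _ m m _ n _ n _ _ m _ n])
    (auto simp: left_add_zero_mat[of _ m m] right_add_zero_mat[of _ m m]
      left_add_zero_mat[of _ n n] right_add_zero_mat[of _ n n])

definition unitary_mat :: "nat \<Rightarrow> complex mat \<Rightarrow> bool" where
  "unitary_mat n U \<longleftrightarrow> U \<in> carrier_mat n n \<and> mat_adjoint U * U = 1\<^sub>m n"

lemma unitary_matD:
  assumes "unitary_mat n U"
  shows "U \<in> carrier_mat n n" "mat_adjoint U \<in> carrier_mat n n"
    "mat_adjoint U * U = 1\<^sub>m n" "U * mat_adjoint U = 1\<^sub>m n"
  using assms mat_mult_left_right_inverse[of "mat_adjoint U" n U]
  by (auto simp: unitary_mat_def)

lemma unitary_mat_mult:
  assumes U: "unitary_mat n U" and W: "unitary_mat n W"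
  shows "unitary_mat n (U * W)"
proof -
  note [simp] = unitary_matD[OF U] unitary_matD[OF W]
  have "mat_adjoint (U * W) * (U * W) = mat_adjoint W * (mat_adjoint U * (U * W))"
    by (subst mat_adjoint_mult[of _ n n _ n], simp, simp, rule assoc_mult_mat[of _ n n _ n _ n])
      (auto intro!: mult_carrier_mat[of _ n n])
  also have "mat_adjoint U * (U * W) = mat_adjoint U * U * W"
    by (rule assoc_mult_mat[symmetric, of _ n n _ n _ n]) simp_all
  finally show ?thesis
    unfolding unitary_mat_def by (simp add: left_mult_one_mat[of W n n])
qed

section \<open>The Euclidean norm of complex vectors\<close>

definition vnorm :: "complex vec \<Rightarrow> real" where
  "vnorm x = L2_set (\<lambda>i. cmod (x $ i)) {..<dim_vec x}"

lemma vnorm_nonneg [simp]: "0 \<le> vnorm x"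
  by (simp add: vnorm_def)

lemma vnorm_sq: "(vnorm x)\<^sup>2 = (\<Sum>i<dim_vec x. (cmod (x $ i))\<^sup>2)"
  by (simp add: vnorm_def L2_set_def sum_nonneg)

lemma vnorm_sq_scalar_prod: "(complex_of_real (vnorm x))\<^sup>2 = x \<bullet>c x"
proof -
  have "(complex_of_real (vnorm x))\<^sup>2 = complex_of_real (\<Sum>i<dim_vec x. (cmod (x $ i))\<^sup>2)"
    by (simp flip: vnorm_sq)
  also have "\<dots> = (\<Sum>i<dim_vec x. x $ i * cnj (x $ i))"
    by (simp add: complex_norm_square del: of_real_power)
  finally show ?thesis by (simp add: scalar_prod_def atLeast0LessThan)
qed

lemma vnorm_eq_0_iff: "x \<in> carrier_vec n \<Longrightarrow> vnorm x = 0 \<longleftrightarrow> x = 0\<^sub>v n"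
  by (auto simp: vnorm_def L2_set_eq_0_iff)

lemma vnorm_triangle:
  assumes "x \<in> carrier_vec n" "y \<in> carrier_vec n"
  shows "vnorm (x + y) \<le> vnorm x + vnorm y"
proof -
  have "vnorm (x + y) = L2_set (\<lambda>i. cmod (x $ i + y $ i)) {..<n}"
    using assms unfolding vnorm_def by (intro L2_set_cong) auto
  also have "\<dots> \<le> L2_set (\<lambda>i. cmod (x $ i) + cmod (y $ i)) {..<n}"
    by (intro L2_set_mono norm_triangle_ineq) auto
  also have "\<dots> \<le> vnorm x + vnorm y"
    using assms L2_set_triangle_ineq[of "\<lambda>i. cmod (x $ i)" "\<lambda>i. cmod (y $ i)" "{..<n}"]
    by (simp add: vnorm_def)
  finally show ?thesis .
qed

lemma vnorm_uminus: "vnorm (- x) = vnorm x"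
  by (auto simp: vnorm_def intro!: L2_set_cong)

lemma vnorm_mono:
  assumes "dim_vec x = dim_vec y" "\<And>i. i < dim_vec y \<Longrightarrow> cmod (x $ i) \<le> c * cmod (y $ i)" "0 \<le> c"
  shows "vnorm x \<le> c * vnorm y"
  unfolding vnorm_def using assms by (auto simp: L2_set_right_distrib intro!: L2_set_mono)

lemma scalar_prod_mat_adjoint:
  fixes A :: "complex mat"
  assumes "A \<in> carrier_mat m n" "x \<in> carrier_vec n" "y \<in> carrier_vec m"
  shows "(A *\<^sub>v x) \<bullet>c y = x \<bullet>c (mat_adjoint A *\<^sub>v y)"
proof -
  have "(A *\<^sub>v x) \<bullet>c y = (\<Sum>i<m. \<Sum>j<n. A $$ (i, j) * x $ j * cnj (y $ i))"
    using assms by (auto simp: scalar_prod_def sum_distrib_right atLeast0LessThan intro!: sum.cong)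
  also have "\<dots> = (\<Sum>j<n. \<Sum>i<m. A $$ (i, j) * x $ j * cnj (y $ i))"
    by (rule sum.swap)
  also have "\<dots> = x \<bullet>c (mat_adjoint A *\<^sub>v y)"
    using assms by (auto simp: scalar_prod_def sum_distrib_left atLeast0LessThan mult_ac intro!: sum.cong)
  finally show ?thesis .
qed

lemma vnorm_sq_mult_mat_vec:
  assumes "A \<in> carrier_mat m n" "x \<in> carrier_vec n"
  shows "(complex_of_real (vnorm (A *\<^sub>v x)))\<^sup>2 = x \<bullet>c ((mat_adjoint A * A) *\<^sub>v x)"
  using assms scalar_prod_mat_adjoint[of A m n x "A *\<^sub>v x"]
  by (simp add: vnorm_sq_scalar_prod assoc_mult_mat_vec[of _ n m _ n])

lemma unitary_vnorm:
  assumes "unitary_mat n U" "x \<in> carrier_vec n"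
  shows "vnorm (U *\<^sub>v x) = vnorm x"
proof -
  have "(complex_of_real (vnorm (U *\<^sub>v x)))\<^sup>2 = (complex_of_real (vnorm x))\<^sup>2"
    using vnorm_sq_mult_mat_vec[of U n n x] assms unitary_matD[OF assms(1)]
    by (simp add: vnorm_sq_scalar_prod)
  then have "(vnorm (U *\<^sub>v x))\<^sup>2 = (vnorm x)\<^sup>2"
    by (metis of_real_eq_iff of_real_power)
  then show ?thesis by simp
qed

section \<open>Unitary diagonalization of Hermitian matrices\<close>

text \<open>
  Gram--Schmidt applied to a basis that starts with \<open>v\<close> leaves \<open>v\<close> in place; dividing
  each column by its norm then makes the matrix unitary.
\<close>
lemma unitary_completion:
  fixes v :: "complex vec"
  assumes v: "v \<in> carrier_vec n" "v \<noteq> 0\<^sub>v n" and n: "n > 0"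
  obtains W c where "unitary_mat n W" "col W 0 = c \<cdot>\<^sub>v v"
proof -
  interpret cof_vec_space n "TYPE(complex)" .
  define b where "b = basis_completion v"
  define ws where "ws = gram_schmidt n b"
  from basis_completion[OF v, folded b_def]
  have b: "distinct b" "\<not> lin_dep (set b)" "set b \<subseteq> carrier_vec n" "hd b = v" "length b = n"
    by auto
  then obtain vs where bv: "b = v # vs" using n by (cases b) auto
  from gram_schmidt_result[OF b(3,1,2) refl, folded ws_def]
  have ws: "set ws \<subseteq> carrier_vec n" "corthogonal ws" "length ws = n"
    by (auto simp: b)
  have hd: "ws ! 0 = v"
    using gram_schmidt_hd[OF v(1), of vs, folded bv] n ws unfolding ws_def
    by (simp add: hd_conv_nth[symmetric] flip: length_greater_0_conv)
  have wsc: "ws ! i \<in> carrier_vec n" if "i < n" for i using ws that by auto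
  define c where "c i = inverse (complex_of_real (vnorm (ws ! i)))" for i
  define W where "W = mat n n (\<lambda>(i, j). c j * (ws ! j) $ i)"
  have "mat_adjoint W * W = 1\<^sub>m n"
  proof (rule eq_matI)
    fix i j assume ij: "i < dim_row (1\<^sub>m n :: complex mat)" "j < dim_col (1\<^sub>m n :: complex mat)"
    then have dims: "dim_vec (ws ! i) = n" "dim_vec (ws ! j) = n" using wsc by auto
    have "(mat_adjoint W * W) $$ (i, j) = (\<Sum>k<n. cnj (c i * (ws ! i) $ k) * (c j * (ws ! j) $ k))"
      using ij by (auto simp: W_def scalar_prod_def atLeast0LessThan intro!: sum.cong)
    also have "\<dots> = cnj (c i) * c j * (ws ! j \<bullet>c ws ! i)"
      using ij dims by (auto simp: scalar_prod_def atLeast0LessThan sum_distrib_left intro!: sum.cong)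
    also have "\<dots> = (if i = j then 1 else 0)"
    proof (cases "i = j")
      case False
      then show ?thesis using corthogonalD[OF ws(2), of j i] ij ws by auto
    next
      case True
      have "ws ! i \<bullet>c ws ! i \<noteq> 0" using corthogonalD[OF ws(2), of i i] ij ws by auto
      then have "vnorm (ws ! i) \<noteq> 0" by (auto simp flip: vnorm_sq_scalar_prod)
      moreover have "ws ! i \<bullet>c ws ! i = complex_of_real (vnorm (ws ! i)) ^ 2"
        by (simp flip: vnorm_sq_scalar_prod)
      ultimately show ?thesis using True by (simp add: c_def power2_eq_square field_simps)
    qed
    finally show "(mat_adjoint W * W) $$ (i, j) = 1\<^sub>m n $$ (i, j)" using ij by simp
  qed (auto simp: W_def)
  then have "unitary_mat n W" by (simp add: unitary_mat_def W_def)
  moreover have "col W 0 = c 0 \<cdot>\<^sub>v v"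
    using n v hd by (intro eq_vecI) (auto simp: W_def)
  ultimately show ?thesis by (rule that)
qed

text \<open>
  The argument is deflation. A unitary \<open>W\<close> whose first column is an eigenvector turns
  \<open>H\<close> into a matrix \<open>K\<close> whose first column is \<open>e\<close> times a unit vector. Because \<open>K\<close>
  is again Hermitian, its first row has the same form, so \<open>K\<close> is block diagonal and the induction
  continues with the remaining block. Prescribing the order of the eigenvalues through \<open>es\<close>
  is what later permits listing them decreasingly.
\<close>
lemma hermitian_diagonalization:
  fixes H :: "complex mat"
  assumes "H \<in> carrier_mat n n" "mat_adjoint H = H"
    and "char_poly H = (\<Prod>e\<leftarrow>es. [:- e, 1:])"
  shows "\<exists>U. unitary_mat n U \<and>
    mat_adjoint U * H * U = mat n n (\<lambda>(i, j). if i = j then es ! i else 0)"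
  using assms
proof (induction es arbitrary: n H)
  case Nil
  then have "n = 0" using degree_monic_char_poly[of H n] by auto
  with Nil show ?case
    by (intro exI[of _ "1\<^sub>m 0"]) (auto simp: unitary_mat_def)
next
  case (Cons e es n H)
  note H = Cons.prems(1)
  have cp: "char_poly H = [:- e, 1:] * (\<Prod>e\<leftarrow>es. [:- e, 1:])"
    using Cons.prems(3) by simp
  have "monic (\<Prod>e\<leftarrow>es. [:- e, 1:])" by (rule monic_prod_list) auto
  then have "degree (char_poly H) = Suc (degree (\<Prod>e\<leftarrow>es. [:- e, 1:]))"
    unfolding cp by (subst degree_mult_eq) auto
  then have "n \<noteq> 0" using degree_monic_char_poly[OF H] by auto
  then obtain m where n: "n = Suc m" by (cases n) auto
  have "eigenvalue H e"
    unfolding eigenvalue_root_char_poly[OF H] cp by simp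
  then obtain v where v: "v \<in> carrier_vec n" "v \<noteq> 0\<^sub>v n" and Hv: "H *\<^sub>v v = e \<cdot>\<^sub>v v"
    using H unfolding eigenvalue_def eigenvector_def by auto
  obtain W c where W: "unitary_mat n W" and colW: "col W 0 = c \<cdot>\<^sub>v v"
    using unitary_completion[OF v] \<open>n \<noteq> 0\<close> by auto
  note Wd = unitary_matD[OF W]
  define K where "K = mat_adjoint W * H * W"
  have K: "K \<in> carrier_mat n n" using Wd H by (simp add: K_def)
  have Kherm: "mat_adjoint K = K"
    unfolding K_def using Wd H Cons.prems(2)
    by (simp add: mat_adjoint_mult[of _ n n _ n] assoc_mult_mat[of _ n n _ n _ n])
  have simKH: "similar_mat K H"
    using K H Wd by (intro similar_matI[of _ _ "mat_adjoint W" W n]) (auto simp: K_def)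
  have "col K 0 = mat_adjoint W * H *\<^sub>v col W 0"
    using Wd H n unfolding K_def by (subst col_mult2[of _ n n _ n]) auto
  also have "\<dots> = mat_adjoint W *\<^sub>v (H *\<^sub>v col W 0)"
    using Wd H by (intro assoc_mult_mat_vec[of _ n n _ n]) (auto intro: col_carrier_vec)
  also have "\<dots> = e \<cdot>\<^sub>v (mat_adjoint W *\<^sub>v col W 0)"
    unfolding colW using Wd H v Hv
    by (simp add: mult_mat_vec[of _ n n] smult_smult_assoc mult.commute)
  also have "mat_adjoint W *\<^sub>v col W 0 = col (mat_adjoint W * W) 0"
    using Wd n by (subst col_mult2[of _ n n _ n]) auto
  also have "\<dots> = unit_vec n 0"
    using Wd n by simp
  finally have colK: "col K 0 = e \<cdot>\<^sub>v unit_vec n 0" .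
  have K0: "K $$ (i, 0) = (if i = 0 then e else 0)" if "i < n" for i
    using arg_cong[OF colK, of "\<lambda>x. x $ i"] that K n by auto
  have K0': "K $$ (0, i) = (if i = 0 then e else 0)" if "i < n" for i
  proof (cases "i = 0")
    case False
    have "K $$ (0, i) = mat_adjoint K $$ (0, i)" by (simp add: Kherm)
    then show ?thesis using K0[of i] that K n False by simp
  qed (use K0[of 0] n in auto)
  define K' where "K' = mat m m (\<lambda>(i, j). K $$ (Suc i, Suc j))"
  define E where "E = mat 1 1 (\<lambda>_. e)"
  have KB: "K = four_block_mat E (0\<^sub>m 1 m) (0\<^sub>m m 1) K'"
    using K K0 K0' n by (intro eq_matI) (auto simp: K'_def E_def)
  have K': "K' \<in> carrier_mat m m" and E: "E \<in> carrier_mat 1 1" by (auto simp: K'_def E_def)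
  have "mat_adjoint K' = K'"
  proof (rule eq_matI)
    fix i j assume "i < dim_row K'" "j < dim_col K'"
    then show "mat_adjoint K' $$ (i, j) = K' $$ (i, j)"
      using arg_cong[OF Kherm, of "\<lambda>M. M $$ (Suc i, Suc j)"] K n by (auto simp: K'_def)
  qed (auto simp: K'_def)
  moreover have "char_poly K' = (\<Prod>e\<leftarrow>es. [:- e, 1:])"
  proof -
    have "char_poly K = char_poly E * char_poly K'"
      unfolding KB by (rule char_poly_four_block_zeros_col[OF E _ K']) simp
    moreover have "char_poly E = [:- e, 1:]"
      by (simp add: E_def char_poly_defs det_def sign_def)
    ultimately have "[:- e, 1:] * char_poly K' = [:- e, 1:] * (\<Prod>e\<leftarrow>es. [:- e, 1:])"
      using char_poly_similar[OF simKH] cp by simp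
    then show ?thesis by (metis mult_cancel_left pCons_eq_0_iff zero_neq_one)
  qed
  ultimately obtain U' where U': "unitary_mat m U'"
    and diag: "mat_adjoint U' * K' * U' = mat m m (\<lambda>(i, j). if i = j then es ! i else 0)"
    using Cons.IH[OF K'] by blast
  note Ud = unitary_matD[OF U']
  define F where "F = four_block_mat (1\<^sub>m 1) (0\<^sub>m 1 m) (0\<^sub>m m 1) U'"
  have Fc: "F \<in> carrier_mat n n" using Ud by (auto simp: F_def n)
  have Fadj: "mat_adjoint F = four_block_mat (1\<^sub>m 1) (0\<^sub>m 1 m) (0\<^sub>m m 1) (mat_adjoint U')"
    unfolding F_def using Ud by (subst mat_adjoint_block_diag) auto
  have "mat_adjoint F * F = four_block_mat (1\<^sub>m 1) (0\<^sub>m 1 m) (0\<^sub>m m 1) (1\<^sub>m m)"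
    unfolding Fadj unfolding F_def using Ud
    by (subst mult_block_diag) auto
  then have F: "unitary_mat n F" using Fc by (simp add: unitary_mat_def n)
  have "mat_adjoint F * K * F = four_block_mat E (0\<^sub>m 1 m) (0\<^sub>m m 1) (mat_adjoint U' * K' * U')"
    unfolding Fadj unfolding F_def KB using Ud E K'
    by (simp add: mult_block_diag left_mult_one_mat[of E 1 1] right_mult_one_mat[of E 1 1])
  also have "\<dots> = mat n n (\<lambda>(i, j). if i = j then (e # es) ! i else 0)"
    unfolding diag by (rule eq_matI) (auto simp: E_def n nth_Cons')
  finally have "mat_adjoint F * K * F = mat n n (\<lambda>(i, j). if i = j then (e # es) ! i else 0)" .
  moreover have "mat_adjoint F * K * F = mat_adjoint (W * F) * H * (W * F)"
    unfolding K_def using Wd Fc H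
    by (simp add: mat_adjoint_mult[of _ n n _ n] assoc_mult_mat[of _ n n _ n _ n])
  ultimately show ?case
    using unitary_mat_mult[OF W F] by (intro exI[of _ "W * F"]) simp
qed

section \<open>Singular values and norms\<close>

lemma char_poly_linear_factors:
  fixes H :: "complex mat"
  assumes "H \<in> carrier_mat n n" "mset es = proots (char_poly H)"
  shows "char_poly H = (\<Prod>e\<leftarrow>es. [:- e, 1:])" "length es = n"
proof -
  have "(\<Prod>e\<in>#proots (char_poly H). [:- e, 1:]) = char_poly H"
    using complex_poly_decompose_multiset[of "char_poly H"] degree_monic_char_poly[OF assms(1)]
    by simp
  then show "char_poly H = (\<Prod>e\<leftarrow>es. [:- e, 1:])"
    by (simp flip: assms(2) prod_mset_prod_list)
  show "length es = n"
    using size_proots_complex[of "char_poly H"] degree_monic_char_poly[OF assms(1)]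
    by (simp flip: assms(2))
qed

lemma unitary_adjoint_vec:
  assumes "unitary_mat n U" "x \<in> carrier_vec n"
  shows "U *\<^sub>v (mat_adjoint U *\<^sub>v x) = x" "vnorm (mat_adjoint U *\<^sub>v x) = vnorm x"
proof -
  note Ud = unitary_matD[OF assms(1)]
  show eq: "U *\<^sub>v (mat_adjoint U *\<^sub>v x) = x"
    using Ud assms(2) by (simp flip: assoc_mult_mat_vec[of _ n n _ n])
  show "vnorm (mat_adjoint U *\<^sub>v x) = vnorm x"
    using unitary_vnorm[OF assms(1), of "mat_adjoint U *\<^sub>v x"] Ud assms(2) by (simp add: eq)
qed

text \<open>
  The right singular vectors. The columns of \<open>U\<close> are an orthonormal eigenbasis of
  \<open>mat_adjoint A * A\<close>, ordered by decreasing eigenvalue. In the coordinates of this basis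
  \<open>x \<mapsto> \<parallel>A x\<parallel>\<^sup>2\<close> is a diagonal quadratic form, and this is the only description of the
  singular values on which the norm and rank estimates rest.
\<close>
lemma singular_value_basis:
  assumes A: "A \<in> carrier_mat m n"
  obtains U where "unitary_mat n U"
    and "\<And>x. x \<in> carrier_vec n \<Longrightarrow> (vnorm (A *\<^sub>v (U *\<^sub>v x)))\<^sup>2 =
      (\<Sum>i<n. (singular_value (Suc i) A)\<^sup>2 * (cmod (x $ i))\<^sup>2)"
    and "\<And>i. i < n \<Longrightarrow> 0 \<le> singular_value (Suc i) A"
    and "\<And>i j. i \<le> j \<Longrightarrow> j < n \<Longrightarrow> singular_value (Suc j) A \<le> singular_value (Suc i) A"
proof -
  define H where "H = mat_adjoint A * A"
  have H: "H \<in> carrier_mat n n" using A by (auto simp: H_def)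
  have herm: "mat_adjoint H = H"
    using A by (simp add: H_def mat_adjoint_mult[of _ n m _ n])
  obtain zs where zs: "mset zs = proots (char_poly H)" using ex_mset by blast
  define f where "f = (\<lambda>z. sqrt (Re z))"
  define es where "es = rev (sort_key f zs)"
  have es: "mset es = proots (char_poly H)" by (simp add: es_def zs)
  have "sort (map f zs) = map f (sort_key f zs)"
    by (rule properties_for_sort) auto
  then have sv: "singular_values A = map f es"
    by (simp add: singular_values_def es_def rev_map sorted_list_of_multiset_mset
        flip: H_def zs mset_map f_def)
  note cp = char_poly_linear_factors[OF H es]
  have svi: "singular_value (Suc i) A = f (es ! i)" if "i < n" for i
    using that by (simp add: singular_value_def sv cp(2))
  obtain U where U: "unitary_mat n U"
    and diag: "mat_adjoint U * H * U = mat n n (\<lambda>(i, j). if i = j then es ! i else 0)"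
    using hermitian_diagonalization[OF H herm cp(1)] by blast
  note Ud = unitary_matD[OF U]
  have expand: "(vnorm (A *\<^sub>v (U *\<^sub>v x)))\<^sup>2 = (\<Sum>i<n. Re (es ! i) * (cmod (x $ i))\<^sup>2)"
    if x: "x \<in> carrier_vec n" for x
  proof -
    have Ux: "U *\<^sub>v x \<in> carrier_vec n" using Ud x by simp
    have "(complex_of_real (vnorm (A *\<^sub>v (U *\<^sub>v x))))\<^sup>2 = (U *\<^sub>v x) \<bullet>c (H *\<^sub>v (U *\<^sub>v x))"
      unfolding H_def by (rule vnorm_sq_mult_mat_vec[OF A Ux])
    also have "\<dots> = x \<bullet>c (mat_adjoint U *\<^sub>v (H *\<^sub>v (U *\<^sub>v x)))"
      using scalar_prod_mat_adjoint[OF Ud(1) x, of "H *\<^sub>v (U *\<^sub>v x)"] H Ux by simp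
    also have "mat_adjoint U *\<^sub>v (H *\<^sub>v (U *\<^sub>v x)) = (mat_adjoint U * H * U) *\<^sub>v x"
      using Ud H x Ux
      by (simp add: assoc_mult_mat_vec[of _ n n U n] assoc_mult_mat_vec[of _ n n H n])
    also have "\<dots> = vec n (\<lambda>i. es ! i * x $ i)"
    proof (rule eq_vecI)
      fix i assume "i < dim_vec (vec n (\<lambda>i. es ! i * x $ i))"
      then have i: "i < n" by simp
      have "((mat_adjoint U * H * U) *\<^sub>v x) $ i = (\<Sum>j<n. (if i = j then es ! i else 0) * x $ j)"
        unfolding diag using i x by (auto simp: scalar_prod_def atLeast0LessThan intro!: sum.cong)
      also have "\<dots> = es ! i * x $ i"
        using i by (simp add: if_distrib[of "\<lambda>a. a * _"] sum.delta cong: if_cong)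
      finally show "((mat_adjoint U * H * U) *\<^sub>v x) $ i = vec n (\<lambda>i. es ! i * x $ i) $ i"
        using i by simp
    qed (use Ud in auto)
    also have "x \<bullet>c vec n (\<lambda>i. es ! i * x $ i) =
        (\<Sum>i<n. cnj (es ! i) * complex_of_real ((cmod (x $ i))\<^sup>2))"
      using x by (auto simp: scalar_prod_def atLeast0LessThan complex_norm_square mult_ac
          simp del: of_real_power intro!: sum.cong)
    finally have "complex_of_real ((vnorm (A *\<^sub>v (U *\<^sub>v x)))\<^sup>2) =
        (\<Sum>i<n. cnj (es ! i) * complex_of_real ((cmod (x $ i))\<^sup>2))" by simp
    from arg_cong[OF this, of Re] show ?thesis
      by (simp add: Re_sum del: of_real_power)
  qed
  \<comment> \<open>On unit vectors the quadratic form returns the eigenvalues, which are thus nonnegative.\<close>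
  have Re_nonneg: "0 \<le> Re (es ! i)" if i: "i < n" for i
  proof -
    have "(vnorm (A *\<^sub>v (U *\<^sub>v unit_vec n i)))\<^sup>2 =
        (\<Sum>j<n. if j = i then Re (es ! j) else 0)"
      unfolding expand[OF unit_vec_carrier] by (intro sum.cong) (auto simp: i)
    also have "\<dots> = Re (es ! i)" using i by simp
    finally show ?thesis by (metis zero_le_power2)
  qed
  have "sorted_wrt (\<ge>) (map f es)"
    unfolding es_def rev_map[symmetric] sorted_wrt_rev
    using sorted_sort_key[of f zs] by simp
  then have decr: "f (es ! j) \<le> f (es ! i)" if "i \<le> j" "j < n" for i j
    using that cp(2) by (cases "i = j") (auto simp: sorted_wrt_iff_nth_less)
  show ?thesis
  proof (rule that[OF U])
    fix x :: "complex vec" assume "x \<in> carrier_vec n"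
    then show "(vnorm (A *\<^sub>v (U *\<^sub>v x)))\<^sup>2 =
      (\<Sum>i<n. (singular_value (Suc i) A)\<^sup>2 * (cmod (x $ i))\<^sup>2)"
      unfolding expand[OF \<open>x \<in> carrier_vec n\<close>]
      by (intro sum.cong) (auto simp: svi f_def Re_nonneg)
  qed (use decr in \<open>auto simp: svi f_def Re_nonneg\<close>)
qed

lemma singular_value_nonneg:
  assumes "A \<in> carrier_mat m n" "1 \<le> k" "k \<le> n"
  shows "0 \<le> singular_value k A"
proof -
  have "\<forall>i<n. 0 \<le> singular_value (Suc i) A"
    by (rule singular_value_basis[OF assms(1)]) blast
  then show ?thesis using assms(2,3) by (cases k) auto
qed

lemma vnorm_mult_le_singular_value:
  assumes A: "A \<in> carrier_mat m n" and x: "x \<in> carrier_vec n"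
  shows "vnorm (A *\<^sub>v x) \<le> singular_value 1 A * vnorm x"
proof (cases "n = 0")
  case True
  then have "vnorm (A *\<^sub>v x) = 0" "vnorm x = 0" using A x
    by (auto simp: vnorm_def L2_set_def scalar_prod_def)
  then show ?thesis by simp
next
  case False
  obtain U where U: "unitary_mat n U"
    and exp: "\<And>x. x \<in> carrier_vec n \<Longrightarrow> (vnorm (A *\<^sub>v (U *\<^sub>v x)))\<^sup>2 =
      (\<Sum>i<n. (singular_value (Suc i) A)\<^sup>2 * (cmod (x $ i))\<^sup>2)"
    and nonneg: "\<And>i. i < n \<Longrightarrow> 0 \<le> singular_value (Suc i) A"
    and decr: "\<And>i j. i \<le> j \<Longrightarrow> j < n \<Longrightarrow> singular_value (Suc j) A \<le> singular_value (Suc i) A"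
    by (rule singular_value_basis[OF A]) (rule that, assumption+)
  define a where "a = mat_adjoint U *\<^sub>v x"
  have a: "a \<in> carrier_vec n" using unitary_matD[OF U] x by (simp add: a_def)
  have "(vnorm (A *\<^sub>v x))\<^sup>2 = (\<Sum>i<n. (singular_value (Suc i) A)\<^sup>2 * (cmod (a $ i))\<^sup>2)"
    using exp[OF a] unitary_adjoint_vec(1)[OF U x] by (simp add: a_def)
  also have "\<dots> \<le> (\<Sum>i<n. (singular_value 1 A)\<^sup>2 * (cmod (a $ i))\<^sup>2)"
    using decr[of 0] nonneg by (intro sum_mono mult_right_mono power_mono) auto
  also have "\<dots> = (singular_value 1 A * vnorm a)\<^sup>2"
    using a by (simp add: power_mult_distrib vnorm_sq sum_distrib_left)
  also have "vnorm a = vnorm x" unfolding a_def by (rule unitary_adjoint_vec(2)[OF U x])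
  finally show ?thesis
    by (rule power2_le_imp_le) (use nonneg[of 0] False in simp)
qed

text \<open>
  Fewer homogeneous linear equations than unknowns have a common nonzero solution; the missing
  equations are represented by a zero row of a square matrix.
\<close>
lemma zero_row_nonzero_kernel:
  fixes M :: "complex mat"
  assumes M: "M \<in> carrier_mat n n" and i: "i < n" and "\<And>j. j < n \<Longrightarrow> M $$ (i, j) = 0"
  obtains x where "x \<in> carrier_vec n" "x \<noteq> 0\<^sub>v n" "M *\<^sub>v x = 0\<^sub>v n"
proof -
  have "transpose_mat M *\<^sub>v unit_vec n i = 0\<^sub>v n"
    using assms by (intro eq_vecI) auto
  moreover have "unit_vec n i \<noteq> (0\<^sub>v n :: complex vec)"
    using i by (metis index_unit_vec(1) index_zero_vec(1) zero_neq_one)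
  ultimately have "det (transpose_mat M) = 0"
    using det_0_iff_vec_prod_zero[of "transpose_mat M" n] M unit_vec_carrier[of n i]
    by (metis transpose_carrier_mat)
  then have "det M = 0" using det_transpose[OF M] by simp
  then show ?thesis using det_0_iff_vec_prod_zero[OF M] that by blast
qed

text \<open>
  One half of Weyl's inequality. Following Courant and Fischer, choose \<open>x \<noteq> 0\<close> in the
  intersection of the span of the first \<open>k\<close> singular vectors of \<open>A\<close> with the span
  of all but the first \<open>k - 1\<close> singular vectors of \<open>B\<close>. Membership amounts to
  \<open>n - k\<close> and \<open>k - 1\<close> linear equations, so such an \<open>x\<close> exists, and it satisfies
  \<open>\<parallel>A x\<parallel> \<ge> \<sigma>\<^sub>k(A) \<parallel>x\<parallel>\<close> and \<open>\<parallel>B x\<parallel> \<le> \<sigma>\<^sub>k(B) \<parallel>x\<parallel>\<close>.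
\<close>
lemma singular_value_perturbation:
  assumes A: "A \<in> carrier_mat m n" and B: "B \<in> carrier_mat m n"
    and k: "1 \<le> k" "k \<le> n"
    and le: "\<And>x. x \<in> carrier_vec n \<Longrightarrow> vnorm (A *\<^sub>v x) \<le> vnorm (B *\<^sub>v x) + \<epsilon> * vnorm x"
  shows "singular_value k A \<le> singular_value k B + \<epsilon>"
proof -
  define i where "i = k - 1"
  have i: "i < n" and ki: "k = Suc i" using k by (auto simp: i_def)
  obtain U where U: "unitary_mat n U"
    and expA: "\<And>x. x \<in> carrier_vec n \<Longrightarrow> (vnorm (A *\<^sub>v (U *\<^sub>v x)))\<^sup>2 =
      (\<Sum>i<n. (singular_value (Suc i) A)\<^sup>2 * (cmod (x $ i))\<^sup>2)"
    and nonnegA: "\<And>i. i < n \<Longrightarrow> 0 \<le> singular_value (Suc i) A"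
    and decrA: "\<And>i j. i \<le> j \<Longrightarrow> j < n \<Longrightarrow> singular_value (Suc j) A \<le> singular_value (Suc i) A"
    by (rule singular_value_basis[OF A]) (rule that, assumption+)
  obtain W where W: "unitary_mat n W"
    and expB: "\<And>x. x \<in> carrier_vec n \<Longrightarrow> (vnorm (B *\<^sub>v (W *\<^sub>v x)))\<^sup>2 =
      (\<Sum>i<n. (singular_value (Suc i) B)\<^sup>2 * (cmod (x $ i))\<^sup>2)"
    and nonnegB: "\<And>i. i < n \<Longrightarrow> 0 \<le> singular_value (Suc i) B"
    and decrB: "\<And>i j. i \<le> j \<Longrightarrow> j < n \<Longrightarrow> singular_value (Suc j) B \<le> singular_value (Suc i) B"
    by (rule singular_value_basis[OF B]) (rule that, assumption+)
  note Ud = unitary_matD[OF U] and Wd = unitary_matD[OF W]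
  \<comment> \<open>Rows before \<open>i\<close> annihilate the leading coordinates with respect to \<open>W\<close>,
    rows after \<open>i\<close> the trailing coordinates with respect to \<open>U\<close>; row \<open>i\<close> is free.\<close>
  define M where "M = mat n n (\<lambda>(p, q). if p < i then mat_adjoint W $$ (p, q)
    else if p = i then 0 else mat_adjoint U $$ (p, q))"
  obtain x where x: "x \<in> carrier_vec n" "x \<noteq> 0\<^sub>v n" "M *\<^sub>v x = 0\<^sub>v n"
    by (rule zero_row_nonzero_kernel[of M n i]) (auto simp: M_def i)
  define a where "a = mat_adjoint U *\<^sub>v x"
  define b where "b = mat_adjoint W *\<^sub>v x"
  have a: "a \<in> carrier_vec n" and b: "b \<in> carrier_vec n" using Ud Wd x by (auto simp: a_def b_def)
  have Mx: "(\<Sum>q<n. M $$ (p, q) * x $ q) = 0" if "p < n" for p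
    using arg_cong[OF x(3), of "\<lambda>v. v $ p"] that x(1)
    by (simp add: M_def scalar_prod_def atLeast0LessThan)
  have a0: "a $ p = 0" if "i < p" "p < n" for p
    using Mx[of p] that x(1) Ud by (simp add: M_def a_def scalar_prod_def atLeast0LessThan)
  have b0: "b $ p = 0" if "p < i" for p
    using Mx[of p] that i x(1) Wd by (simp add: M_def b_def scalar_prod_def atLeast0LessThan)
  have xa: "(vnorm x)\<^sup>2 = (\<Sum>p<n. (cmod (a $ p))\<^sup>2)"
    using unitary_adjoint_vec(2)[OF U x(1), folded a_def] vnorm_sq[of a] a by simp
  have xb: "(vnorm x)\<^sup>2 = (\<Sum>p<n. (cmod (b $ p))\<^sup>2)"
    using unitary_adjoint_vec(2)[OF W x(1), folded b_def] vnorm_sq[of b] b by simp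
  have "(singular_value k A * vnorm x)\<^sup>2 = (\<Sum>p<n. (singular_value k A)\<^sup>2 * (cmod (a $ p))\<^sup>2)"
    by (simp add: power_mult_distrib xa sum_distrib_left)
  also have "\<dots> \<le> (\<Sum>p<n. (singular_value (Suc p) A)\<^sup>2 * (cmod (a $ p))\<^sup>2)"
  proof (rule sum_mono)
    fix p assume "p \<in> {..<n}"
    then show "(singular_value k A)\<^sup>2 * (cmod (a $ p))\<^sup>2 \<le>
        (singular_value (Suc p) A)\<^sup>2 * (cmod (a $ p))\<^sup>2"
      using a0[of p] decrA[of p i] nonnegA[OF i] i
      by (cases "p \<le> i") (auto simp: ki intro!: mult_right_mono power_mono)
  qed
  also have "\<dots> = (vnorm (A *\<^sub>v x))\<^sup>2"
    using expA[OF a] unitary_adjoint_vec(1)[OF U x(1)] by (simp add: a_def)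
  finally have lower: "singular_value k A * vnorm x \<le> vnorm (A *\<^sub>v x)"
    by (rule power2_le_imp_le) simp
  have "(vnorm (B *\<^sub>v x))\<^sup>2 = (\<Sum>p<n. (singular_value (Suc p) B)\<^sup>2 * (cmod (b $ p))\<^sup>2)"
    using expB[OF b] unitary_adjoint_vec(1)[OF W x(1)] by (simp add: b_def)
  also have "\<dots> \<le> (\<Sum>p<n. (singular_value k B)\<^sup>2 * (cmod (b $ p))\<^sup>2)"
  proof (rule sum_mono)
    fix p assume "p \<in> {..<n}"
    then show "(singular_value (Suc p) B)\<^sup>2 * (cmod (b $ p))\<^sup>2 \<le>
        (singular_value k B)\<^sup>2 * (cmod (b $ p))\<^sup>2"
      using b0[of p] decrB[of i p] nonnegB[of p] i
      by (cases "i \<le> p") (auto simp: ki intro!: mult_right_mono power_mono)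
  qed
  also have "\<dots> = (singular_value k B * vnorm x)\<^sup>2"
    by (simp add: power_mult_distrib xb sum_distrib_left)
  finally have upper: "vnorm (B *\<^sub>v x) \<le> singular_value k B * vnorm x"
    by (rule power2_le_imp_le) (use nonnegB[OF i] in \<open>simp add: ki\<close>)
  have "vnorm x > 0" using x vnorm_eq_0_iff[OF x(1)] by (simp add: less_le)
  moreover have "singular_value k A * vnorm x \<le> (singular_value k B + \<epsilon>) * vnorm x"
    using lower upper le[OF x(1)] by (simp add: algebra_simps)
  ultimately show ?thesis by simp
qed

text \<open>
  The Gram matrices of \<open>B\<close> and \<open>B * U\<close> are similar, so they have the same
  characteristic polynomial.
\<close>
lemma singular_value_mult_unitary:
  assumes B: "B \<in> carrier_mat m n" and U: "unitary_mat n U"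
  shows "singular_value k (B * U) = singular_value k B"
proof -
  note Ud = unitary_matD[OF U]
  define H where "H = mat_adjoint B * B"
  have H: "H \<in> carrier_mat n n" using B by (auto simp: H_def)
  have BU: "mat_adjoint B * (B * U) = H * U"
    unfolding H_def by (rule assoc_mult_mat[symmetric, of _ n m _ n _ n]) (use B Ud in simp_all)
  have "mat_adjoint (B * U) * (B * U) = mat_adjoint U * mat_adjoint B * (B * U)"
    using B Ud(1) by (simp add: mat_adjoint_mult[of B m n U n])
  also have "\<dots> = mat_adjoint U * (mat_adjoint B * (B * U))"
    by (rule assoc_mult_mat[of _ n n _ m _ n]) (use B Ud in simp_all)
  also have "\<dots> = mat_adjoint U * H * U"
    unfolding BU by (rule assoc_mult_mat[symmetric, of _ n n _ n _ n]) (use H Ud in simp_all)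
  finally have "similar_mat (mat_adjoint (B * U) * (B * U)) H"
    using similar_matI[of "mat_adjoint U * H * U" H "mat_adjoint U" U n] H Ud by simp
  from char_poly_similar[OF this] show ?thesis
    by (simp add: singular_value_def singular_values_def H_def)
qed

section \<open>Rank from positive singular values\<close>

text \<open>
  The \<open>r\<close> columns of \<open>A * Q\<close> are linearly independent and lie in the column space
  of \<open>A\<close>.
\<close>
lemma (in vec_space) rank_ge_if_injective:
  assumes A: "A \<in> carrier_mat n nc" and Q: "Q \<in> carrier_mat nc r"
    and inj: "\<And>y. y \<in> carrier_vec r \<Longrightarrow> A *\<^sub>v (Q *\<^sub>v y) = 0\<^sub>v n \<Longrightarrow> y = 0\<^sub>v r"
  shows "r \<le> rank A"
proof -
  define M where "M = A * Q"
  have M: "M \<in> carrier_mat n r" using A Q by (simp add: M_def)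
  have Mv: "M *\<^sub>v y = A *\<^sub>v (Q *\<^sub>v y)" if "y \<in> carrier_vec r" for y
    unfolding M_def using A Q that by (rule assoc_mult_mat_vec)
  have "distinct (cols M)"
  proof (rule ccontr)
    assume "\<not> distinct (cols M)"
    then obtain i j where ij: "i < r" "j < r" "i \<noteq> j" "col M i = col M j"
      using M by (auto simp: distinct_conv_nth)
    define y :: "'a vec" where "y = unit_vec r i - unit_vec r j"
    have "M *\<^sub>v y = M *\<^sub>v unit_vec r i - M *\<^sub>v unit_vec r j"
      unfolding y_def using M by (intro mult_minus_distrib_mat_vec) auto
    also have "\<dots> = col M i - col M j"
      using M ij(1,2) by (auto intro!: eq_vecI)
    also have "\<dots> = 0\<^sub>v n" using M by (auto intro!: eq_vecI simp: ij(4) simp del: index_col)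
    finally have "y = 0\<^sub>v r" using inj[of y] Mv[of y] by (simp add: y_def)
    then have "y $ i = 0" using ij by simp
    then show False using ij by (simp add: y_def)
  qed
  moreover have "lin_indpt (set (cols M))"
  proof
    assume "lin_dep (set (cols M))"
    then obtain y where "y \<in> carrier_vec r" "y \<noteq> 0\<^sub>v r" "M *\<^sub>v y = 0\<^sub>v n"
      using lin_depE[OF M] \<open>distinct (cols M)\<close> by blast
    then show False using inj Mv by auto
  qed
  ultimately have "rank M = r" using lin_indpt_full_rank[OF M] by blast
  moreover have "rank M \<le> rank A"
  proof -
    have cA: "set (cols A) \<subseteq> carrier_vec n" and cM: "set (cols M) \<subseteq> carrier_vec n"
      using A M cols_dim by blast+
    have "set (cols M) \<subseteq> span (set (cols A))"
    proof
      fix v assume "v \<in> set (cols M)"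
      then obtain j where j: "j < r" "v = col M j"
        using M by (auto simp: in_set_conv_nth)
      have "v = A *\<^sub>v col Q j" unfolding j(2) M_def by (rule col_mult2[OF A Q j(1)])
      then have "v \<in> col_space A"
        unfolding col_space_eq[OF A] using A Q j by auto
      then show "v \<in> span (set (cols A))" by (simp add: col_space_def)
    qed
    then have sub: "span (set (cols M)) \<subseteq> span (set (cols A))"
      using span_is_subset[OF _ span_is_submodule[OF cA]] by blast
    have subA: "VectorSpace.subspace class_ring (span (set (cols A))) V"
      and subM: "VectorSpace.subspace class_ring (span (set (cols M))) V"
      using cA cM span_is_subspace by auto
    show ?thesis
      unfolding rank_def
      using vectorspace.subspace_dim[OF subspace_is_vs[OF subA] nested_subspaces[OF subA subM sub]]
        fin_dim_span_cols[OF A] fin_dim_span_cols[OF M] by simp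
  qed
  ultimately show ?thesis by simp
qed

lemma (in vec_space) rank_le_nr:
  assumes A: "A \<in> carrier_mat n nc"
  shows "rank A \<le> n"
proof -
  have "VectorSpace.subspace class_ring (span (set (cols A))) V"
    using A cols_dim span_is_subspace by auto
  then show ?thesis
    unfolding rank_def using subspace_dim[OF _ fin_dim fin_dim_span_cols[OF A]] dim_is_n by simp
qed

text \<open>
  \<open>A\<close> is injective on the span of its first \<open>r\<close> right singular vectors, because
  there the diagonal quadratic form has only positive coefficients.
\<close>
lemma rank_ge_if_singular_value_pos:
  assumes A: "A \<in> carrier_mat m n" and r: "1 \<le> r" "r \<le> n" and pos: "0 < singular_value r A"
  shows "r \<le> vec_space.rank m A"
proof -
  obtain U where U: "unitary_mat n U"
    and exp: "\<And>x. x \<in> carrier_vec n \<Longrightarrow> (vnorm (A *\<^sub>v (U *\<^sub>v x)))\<^sup>2 =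
      (\<Sum>i<n. (singular_value (Suc i) A)\<^sup>2 * (cmod (x $ i))\<^sup>2)"
    and "\<And>i. i < n \<Longrightarrow> 0 \<le> singular_value (Suc i) A"
    and decr: "\<And>i j. i \<le> j \<Longrightarrow> j < n \<Longrightarrow> singular_value (Suc j) A \<le> singular_value (Suc i) A"
    by (rule singular_value_basis[OF A]) (rule that, assumption+)
  note Ud = unitary_matD[OF U]
  define Q where "Q = mat n r (\<lambda>(i, j). U $$ (i, j))"
  show ?thesis
  proof (rule vec_space.rank_ge_if_injective[OF A, of Q r])
    show "Q \<in> carrier_mat n r" by (simp add: Q_def)
    fix y :: "complex vec" assume y: "y \<in> carrier_vec r" and 0: "A *\<^sub>v (Q *\<^sub>v y) = 0\<^sub>v m"
    define x where "x = vec n (\<lambda>i. if i < r then y $ i else 0)"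
    have "Q *\<^sub>v y = U *\<^sub>v x"
    proof (rule eq_vecI)
      fix i assume "i < dim_vec (U *\<^sub>v x)"
      then have i: "i < n" using Ud by simp
      have "(U *\<^sub>v x) $ i = (\<Sum>j<n. U $$ (i, j) * (if j < r then y $ j else 0))"
        using i Ud by (auto simp: scalar_prod_def x_def atLeast0LessThan intro!: sum.cong)
      also have "\<dots> = (\<Sum>j<r. U $$ (i, j) * y $ j)"
        using r by (intro sum.mono_neutral_cong_right) auto
      finally show "(Q *\<^sub>v y) $ i = (U *\<^sub>v x) $ i"
        using i y by (auto simp: Q_def scalar_prod_def atLeast0LessThan)
    qed (use Ud in \<open>auto simp: Q_def\<close>)
    then have "vnorm (A *\<^sub>v (U *\<^sub>v x)) = 0" using 0 by (simp add: vnorm_def L2_set_def)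
    then have sum0: "(\<Sum>i<n. (singular_value (Suc i) A)\<^sup>2 * (cmod (x $ i))\<^sup>2) = 0"
      using exp[of x] by (simp add: x_def)
    have "x $ i = 0" if "i < r" for i
    proof -
      have "(singular_value (Suc i) A)\<^sup>2 * (cmod (x $ i))\<^sup>2 = 0"
        using sum0 that r by (subst (asm) sum_nonneg_eq_0_iff) auto
      moreover have "singular_value (Suc i) A > 0"
        using decr[of i "r - 1"] that r pos by force
      ultimately show ?thesis by simp
    qed
    then show "y = 0\<^sub>v r" using y r by (intro eq_vecI) (auto simp: x_def)
  qed
qed

section \<open>The entrywise multiplier estimate\<close>

text \<open>
  Multiplying column \<open>k\<close> of \<open>V\<close> by a number in \<open>[-1, 1]\<close> or row \<open>j\<close> by a number
  of modulus at most \<open>c\<close> costs a factor \<open>1\<close> or \<open>c\<close> in the operator bound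
  \<open>\<beta>\<close>. The multiplier \<open>g (a k) j\<close> depends on both indices, but it is a telescoping sum
  over the distinct values \<open>s < t\<close> of \<open>a\<close>: the increment \<open>g t j - g s j\<close> is a pure
  row multiplier of size at most \<open>h t - h s\<close>, applied only to the columns with
  \<open>a k \<ge> t\<close>, which is a pure column multiplier. The sizes telescope to \<open>h l\<close>.
\<close>
lemma multiplier_bound:
  fixes g :: "real \<Rightarrow> nat \<Rightarrow> real" and h :: "real \<Rightarrow> real"
  assumes V: "V \<in> carrier_mat m n" and "0 < m" and \<beta>: "0 \<le> \<beta>"
    and bound: "\<And>x. x \<in> carrier_vec n \<Longrightarrow> vnorm (V *\<^sub>v x) \<le> \<beta> * vnorm x"
    and g0: "\<And>j. g 0 j = 0" and h0: "h 0 = 0"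
    and inc: "\<And>s t j. 0 \<le> s \<Longrightarrow> s \<le> t \<Longrightarrow> t \<le> l \<Longrightarrow> j < m \<Longrightarrow> \<bar>g t j - g s j\<bar> \<le> h t - h s"
    and x: "x \<in> carrier_vec n"
    and a: "\<And>k. k < n \<Longrightarrow> 0 \<le> a k \<and> a k \<le> l" and l: "0 \<le> l"
  shows "vnorm (vec m (\<lambda>j. \<Sum>k<n. complex_of_real (g (a k) j) * V $$ (j, k) * x $ k))
    \<le> h l * (\<beta> * vnorm x)"
proof -
  let ?S = "\<lambda>a. vec m (\<lambda>j. \<Sum>k<n. complex_of_real (g (a k) j) * V $$ (j, k) * x $ k)"
  have h_mono: "h s \<le> h t" if "0 \<le> s" "s \<le> t" "t \<le> l" for s t
    using inc[of s t 0] that \<open>0 < m\<close> by linarith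
  \<comment> \<open>Induction on the set of values: the largest value \<open>b\<close> is lowered to its predecessor \<open>s\<close>,
    and \<open>z\<close> keeps the coordinates of \<open>x\<close> for which this changes something.\<close>
  have step: "vnorm (?S a) \<le> h (Max (insert 0 D)) * (\<beta> * vnorm x)"
    if "finite D" "D \<subseteq> {0..l}" "\<forall>k<n. a k \<in> insert 0 D" for D a
    using that
  proof (induction D arbitrary: a rule: finite_linorder_max_induct)
    case empty
    then have "?S a = 0\<^sub>v m" by (intro eq_vecI) (auto simp: g0)
    then have "vnorm (?S a) = 0" using vnorm_eq_0_iff[of "?S a" m] by simp
    then show ?case by (simp add: h0)
  next
    case (insert b D)
    define s where "s = Max (insert 0 D)"
    have s: "s \<in> insert 0 D" unfolding s_def using insert by (intro Max_in) auto
    have b: "0 \<le> b" "b \<le> l" "0 \<le> s" "s \<le> b" using insert.prems insert.hyps s by auto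
    have mx: "Max (insert 0 (insert b D)) = b"
      using insert.hyps b by (intro Max_eqI) auto
    define a' where "a' k = (if a k \<in> insert 0 D then a k else s)" for k
    define z where "z = vec n (\<lambda>k. if a k \<in> insert 0 D then 0 else x $ k)"
    have z: "z \<in> carrier_vec n" by (simp add: z_def)
    have "vnorm z \<le> 1 * vnorm x"
      by (rule vnorm_mono) (use x in \<open>auto simp: z_def\<close>)
    define w where "w = vec m (\<lambda>j. complex_of_real (g b j - g s j) * (V *\<^sub>v z) $ j)"
    have "?S a = ?S a' + w"
    proof (rule eq_vecI)
      fix j assume "j < dim_vec (?S a' + w)"
      then have j: "j < m" by (simp add: w_def)
      have "(\<Sum>k<n. complex_of_real (g (a k) j) * V $$ (j, k) * x $ k) =
          (\<Sum>k<n. complex_of_real (g (a' k) j) * V $$ (j, k) * x $ k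
            + complex_of_real (g b j - g s j) * (V $$ (j, k) * z $ k))"
        using insert.prems(2)
        by (intro sum.cong) (auto simp: a'_def z_def algebra_simps)
      also have "\<dots> = (?S a' + w) $ j"
        using j V z
        by (simp add: sum.distrib w_def scalar_prod_def atLeast0LessThan sum_distrib_left)
      finally show "?S a $ j = (?S a' + w) $ j" using j by simp
    qed (simp add: w_def)
    then have "vnorm (?S a) \<le> vnorm (?S a') + vnorm w"
      using vnorm_triangle[of "?S a'" m w] by (simp add: w_def)
    also have "vnorm (?S a') \<le> h s * (\<beta> * vnorm x)"
      unfolding s_def using s insert.prems(1) by (intro insert.IH) (auto simp: a'_def s_def)
    also have "vnorm w \<le> (h b - h s) * vnorm (V *\<^sub>v z)"
    proof (rule vnorm_mono)
      fix j assume "j < dim_vec (V *\<^sub>v z)"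
      then have j: "j < m" using V by simp
      then have "cmod (w $ j) = \<bar>g b j - g s j\<bar> * cmod ((V *\<^sub>v z) $ j)"
        by (simp add: w_def norm_mult del: of_real_diff)
      also have "\<dots> \<le> (h b - h s) * cmod ((V *\<^sub>v z) $ j)"
        using inc[of s b j] b j by (intro mult_right_mono) auto
      finally show "cmod (w $ j) \<le> (h b - h s) * cmod ((V *\<^sub>v z) $ j)" .
    qed (use V h_mono[of s b] b in \<open>auto simp: w_def\<close>)
    also have "\<dots> \<le> (h b - h s) * (\<beta> * vnorm x)"
      using order_trans[OF bound[OF z] mult_left_mono[OF \<open>vnorm z \<le> 1 * vnorm x\<close> \<beta>]] h_mono[of s b] b
      by (intro mult_left_mono) auto
    finally show ?case unfolding mx by (simp add: algebra_simps)
  qed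
  let ?D = "a ` {..<n}"
  have "Max (insert 0 ?D) \<le> l" "0 \<le> Max (insert 0 ?D)"
    using a l by (auto intro!: Max_ge)
  then have "h (Max (insert 0 ?D)) * (\<beta> * vnorm x) \<le> h l * (\<beta> * vnorm x)"
    using h_mono \<beta> by (intro mult_right_mono) auto
  then show ?thesis
    using step[of ?D a] a by force
qed

text \<open>
  The increment is even in \<open>\<theta>\<close> and increases from \<open>0\<close> on \<open>[0, \<pi>]\<close>, so its extreme value
  is the one at \<open>\<theta> = \<pi>\<close>.
\<close>
lemma cos_increment_bound:
  fixes s t \<theta> :: real
  assumes "0 \<le> s" "s \<le> t" "t \<le> 1/2" "\<bar>\<theta>\<bar> \<le> pi"
  shows "\<bar>cos (t * \<theta>) - cos (s * \<theta>)\<bar> \<le> cos (pi * s) - cos (pi * t)"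
proof -
  define f where "f u = cos (s * u) - cos (t * u)" for u :: real
  have mono: "f u \<le> f v" if "0 \<le> u" "u \<le> v" "v \<le> pi" for u v
  proof (rule DERIV_nonneg_imp_nondecreasing[OF that(2)])
    fix y assume y: "u \<le> y" "y \<le> v"
    have ty: "0 \<le> s * y" "s * y \<le> t * y" "t * y \<le> pi / 2"
      using y that assms mult_mono[of t "1/2" y pi] by (auto intro: mult_right_mono)
    have "sin (s * y) \<le> sin (t * y)" "0 \<le> sin (s * y)"
      using ty pi_gt_zero by (intro sin_monotone_2pi_le sin_ge_zero; linarith)+
    then have "s * sin (s * y) \<le> t * sin (t * y)"
      using assms by (intro mult_mono) auto
    moreover have "(f has_real_derivative t * sin (t * y) - s * sin (s * y)) (at y)"
      unfolding f_def by (auto intro!: derivative_eq_intros)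
    ultimately show "\<exists>d. (f has_real_derivative d) (at y) \<and> 0 \<le> d" by force
  qed
  have "f \<theta> = f \<bar>\<theta>\<bar>" by (auto simp: f_def abs_if)
  moreover have "0 \<le> f \<bar>\<theta>\<bar>" using mono[of 0 "\<bar>\<theta>\<bar>"] assms by (simp add: f_def)
  moreover have "f \<bar>\<theta>\<bar> \<le> f pi" using mono[of "\<bar>\<theta>\<bar>" pi] assms by simp
  ultimately show ?thesis by (simp add: f_def mult.commute abs_minus_commute)
qed

text \<open>
  As for the cosine, the extreme value is at \<open>\<theta> = \<pi>\<close>. Monotonicity in \<open>\<theta>\<close> needs that
  \<open>r cos (r y)\<close> increases with \<open>r\<close>. Its derivative \<open>cos (r y) - r y sin (r y)\<close> is
  nonnegative because \<open>r y \<le> \<pi>/4\<close>, where \<open>sin \<le> cos\<close> and \<open>r y < 1\<close>; this is where the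
  bound \<open>1/4\<close> comes from.
\<close>
lemma sin_increment_bound:
  fixes s t \<theta> :: real
  assumes "0 \<le> s" "s \<le> t" "t \<le> 1/4" "\<bar>\<theta>\<bar> \<le> pi"
  shows "\<bar>sin (t * \<theta>) - sin (s * \<theta>)\<bar> \<le> sin (pi * t) - sin (pi * s)"
proof -
  have slope: "s * cos (s * y) \<le> t * cos (t * y)" if y: "0 \<le> y" "y \<le> pi" for y
  proof (rule DERIV_nonneg_imp_nondecreasing[OF assms(2)])
    fix r assume r: "s \<le> r" "r \<le> t"
    have ry: "0 \<le> r * y" "r * y \<le> pi / 4"
      using r y assms mult_mono[of r "1/4" y pi] by auto
    have "sin (r * y) \<le> sin (pi / 2 - r * y)"
      using ry by (intro sin_monotone_2pi_le) auto
    then have "sin (r * y) \<le> cos (r * y)" by (simp add: cos_sin_eq)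
    moreover have "r * y * sin (r * y) \<le> 1 * sin (r * y)"
      using ry pi_less_4 by (intro mult_right_mono sin_ge_zero) auto
    ultimately have "0 \<le> cos (r * y) - r * y * sin (r * y)" by simp
    moreover have "((\<lambda>r. r * cos (r * y)) has_real_derivative cos (r * y) - r * y * sin (r * y)) (at r)"
      by (auto intro!: derivative_eq_intros)
    ultimately show "\<exists>d. ((\<lambda>r. r * cos (r * y)) has_real_derivative d) (at r) \<and> 0 \<le> d" by blast
  qed
  define f where "f u = sin (t * u) - sin (s * u)" for u :: real
  have mono: "f u \<le> f v" if "0 \<le> u" "u \<le> v" "v \<le> pi" for u v
  proof (rule DERIV_nonneg_imp_nondecreasing[OF that(2)])
    fix y assume y: "u \<le> y" "y \<le> v"
    have "(f has_real_derivative t * cos (t * y) - s * cos (s * y)) (at y)"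
      unfolding f_def by (auto intro!: derivative_eq_intros)
    then show "\<exists>d. (f has_real_derivative d) (at y) \<and> 0 \<le> d"
      using slope[of y] y that by force
  qed
  have "\<bar>f \<theta>\<bar> = \<bar>f \<bar>\<theta>\<bar>\<bar>" by (auto simp: f_def abs_if)
  moreover have "0 \<le> f \<bar>\<theta>\<bar>" using mono[of 0 "\<bar>\<theta>\<bar>"] assms by (simp add: f_def)
  moreover have "f \<bar>\<theta>\<bar> \<le> f pi" using mono[of "\<bar>\<theta>\<bar>" pi] assms by simp
  ultimately show ?thesis by (simp add: f_def mult.commute)
qed

section \<open>Perturbing the nodes of a Vandermonde matrix\<close>

definition phase_mat :: "nat \<Rightarrow> (nat \<Rightarrow> real) \<Rightarrow> complex mat" where
  "phase_mat n \<phi> = mat n n (\<lambda>(i, j). if i = j then cis (\<phi> i) else 0)"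

lemma phase_mat_carrier [simp]: "phase_mat n \<phi> \<in> carrier_mat n n"
  by (simp add: phase_mat_def)

lemma index_mult_phase_mat:
  assumes "A \<in> carrier_mat m n" "i < m" "j < n"
  shows "(A * phase_mat n \<phi>) $$ (i, j) = A $$ (i, j) * cis (\<phi> j)"
proof -
  have "(A * phase_mat n \<phi>) $$ (i, j) = (\<Sum>k<n. A $$ (i, k) * (if k = j then cis (\<phi> k) else 0))"
    using assms by (auto simp: phase_mat_def scalar_prod_def atLeast0LessThan intro!: sum.cong)
  also have "\<dots> = (\<Sum>k<n. if k = j then A $$ (i, k) * cis (\<phi> k) else 0)"
    by (intro sum.cong) auto
  finally show ?thesis using assms by simp
qed

lemma unitary_phase_mat: "unitary_mat n (phase_mat n \<phi>)"
proof -
  have adj: "mat_adjoint (phase_mat n \<phi>) \<in> carrier_mat n n" by simp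
  have "mat_adjoint (phase_mat n \<phi>) * phase_mat n \<phi> = 1\<^sub>m n"
  proof (rule eq_matI)
    fix i j assume ij: "i < dim_row (1\<^sub>m n :: complex mat)" "j < dim_col (1\<^sub>m n :: complex mat)"
    then have "(mat_adjoint (phase_mat n \<phi>) * phase_mat n \<phi>) $$ (i, j) =
        mat_adjoint (phase_mat n \<phi>) $$ (i, j) * cis (\<phi> j)"
      by (intro index_mult_phase_mat[OF adj]) auto
    then show "(mat_adjoint (phase_mat n \<phi>) * phase_mat n \<phi>) $$ (i, j) = 1\<^sub>m n $$ (i, j)"
      using ij by (auto simp: phase_mat_def cis_cnj cis_mult)
  qed (auto simp: phase_mat_def)
  then show ?thesis by (simp add: unitary_mat_def)
qed

text \<open>
  Moving node \<open>k\<close> by \<open>\<delta>\<^sub>k / L\<close> multiplies entry \<open>(j, k)\<close> by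
  \<open>cis (2 \<pi> j \<delta>\<^sub>k / L)\<close>. The unitary phase matrix centres the frequencies
  \<open>2 \<pi> j / L\<close>: the multiplier becomes \<open>cis (\<delta>\<^sub>k \<theta>\<^sub>j)\<close> with
  \<open>\<theta>\<^sub>j \<in> [-\<pi>, \<pi>)\<close>. Its deviation from \<open>1\<close> splits into
  \<open>cos (\<bar>\<delta>\<^sub>k\<bar> \<theta>\<^sub>j) - 1\<close> and
  \<open>\<i> sgn \<delta>\<^sub>k sin (\<bar>\<delta>\<^sub>k\<bar> \<theta>\<^sub>j)\<close>. The multiplier estimate bounds these by
  \<open>1 - cos (\<pi> l)\<close> and \<open>sin (\<pi> l)\<close>, whose sum is \<open>C(l)\<close>; in the second one the sign
  is absorbed into the vector \<open>x\<close>.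
\<close>
lemma vandermonde_perturbation:
  fixes u \<delta> :: "nat \<Rightarrow> real"
  assumes L: "0 < L" and l: "0 \<le> l" "l \<le> 1/4" and \<delta>: "\<And>k. k < N \<Longrightarrow> \<bar>\<delta> k\<bar> \<le> l"
  defines "V \<equiv> vandermonde L N u"
    and "V' \<equiv> vandermonde L N (\<lambda>k. u k + \<delta> k / real L) * phase_mat N (\<lambda>k. - pi * \<delta> k)"
  assumes \<beta>: "0 \<le> \<beta>"
    and bound: "\<And>x. x \<in> carrier_vec N \<Longrightarrow> vnorm (V *\<^sub>v x) \<le> \<beta> * vnorm x"
    and x: "x \<in> carrier_vec N"
  shows "\<exists>d \<in> carrier_vec L. V' *\<^sub>v x = V *\<^sub>v x + d \<and> vnorm d \<le> kadec_C l * \<beta> * vnorm x"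
proof -
  have V: "V \<in> carrier_mat L N" by (simp add: V_def vandermonde_def)
  have V': "V' \<in> carrier_mat L N" 
    unfolding V'_def by (rule mult_carrier_mat[OF _ phase_mat_carrier]) (simp add: vandermonde_def)
  define \<theta> where "\<theta> j = 2 * pi * real j / real L - pi" for j :: nat
  have \<theta>: "\<bar>\<theta> j\<bar> \<le> pi" if "j < L" for j
  proof -
    have "0 \<le> real j / real L" "real j / real L \<le> 1" using that by auto
    then have "0 \<le> pi * (real j / real L)" "pi * (real j / real L) \<le> pi * 1"
      using mult_left_mono[of "real j / real L" 1 pi] by simp_all
    then show ?thesis by (simp add: \<theta>_def abs_le_iff)
  qed
  have entry: "V' $$ (j, k) = V $$ (j, k) * cis (\<delta> k * \<theta> j)" if "j < L" "k < N" for j k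
  proof -
    have "V' $$ (j, k) = vandermonde L N (\<lambda>k. u k + \<delta> k / real L) $$ (j, k) * cis (- pi * \<delta> k)"
      unfolding V'_def using that by (intro index_mult_phase_mat[where m = L]) (auto simp: vandermonde_def)
    also have "\<dots> = V $$ (j, k) * cis (\<delta> k * \<theta> j)"
      using that L by (simp add: V_def vandermonde_def cis_conv_exp \<theta>_def field_simps flip: exp_add)
    finally show ?thesis .
  qed
  define dc where "dc = vec L (\<lambda>j. \<Sum>k<N. complex_of_real (cos (\<bar>\<delta> k\<bar> * \<theta> j) - 1) * V $$ (j, k) * x $ k)"
  define xs where "xs = vec N (\<lambda>k. \<i> * complex_of_real (sgn (\<delta> k)) * x $ k)"
  define ds where "ds = vec L (\<lambda>j. \<Sum>k<N. complex_of_real (sin (\<bar>\<delta> k\<bar> * \<theta> j)) * V $$ (j, k) * xs $ k)"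
  have "V' *\<^sub>v x = V *\<^sub>v x + (dc + ds)"
  proof (rule eq_vecI)
    fix j assume "j < dim_vec (V *\<^sub>v x + (dc + ds))"
    then have j: "j < L" by (simp add: ds_def)
    have "cis (\<delta> k * \<theta> j) = 1 + complex_of_real (cos (\<bar>\<delta> k\<bar> * \<theta> j) - 1)
        + complex_of_real (sin (\<bar>\<delta> k\<bar> * \<theta> j)) * (\<i> * complex_of_real (sgn (\<delta> k)))" for k
      by (auto simp: complex_eq_iff abs_if sgn_if)
    then have "(\<Sum>k<N. V' $$ (j, k) * x $ k) = (\<Sum>k<N. V $$ (j, k) * x $ k
        + (complex_of_real (cos (\<bar>\<delta> k\<bar> * \<theta> j) - 1) * V $$ (j, k) * x $ k
        + complex_of_real (sin (\<bar>\<delta> k\<bar> * \<theta> j)) * V $$ (j, k) * xs $ k))"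
      using j by (intro sum.cong) (simp_all add: entry xs_def algebra_simps)
    then show "(V' *\<^sub>v x) $ j = (V *\<^sub>v x + (dc + ds)) $ j"
      using V V' x j by (simp add: scalar_prod_def atLeast0LessThan dc_def ds_def sum.distrib)
  qed (use V V' in \<open>auto simp: ds_def\<close>)
  moreover have "vnorm (dc + ds) \<le> kadec_C l * \<beta> * vnorm x"
  proof -
    have "vnorm dc \<le> (1 - cos (pi * l)) * (\<beta> * vnorm x)"
      unfolding dc_def
      by (rule multiplier_bound[OF V L \<beta> bound _ _ _ x, where h = "\<lambda>t. 1 - cos (pi * t)" and l = l
            and g = "\<lambda>t j. cos (t * \<theta> j) - 1" and a = "\<lambda>k. \<bar>\<delta> k\<bar>"])
        (use l \<delta> \<theta> cos_increment_bound in auto)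
    moreover have "vnorm ds \<le> sin (pi * l) * (\<beta> * vnorm xs)"
      unfolding ds_def
      by (rule multiplier_bound[OF V L \<beta> bound, where h = "\<lambda>t. sin (pi * t)" and l = l
            and g = "\<lambda>t j. sin (t * \<theta> j)" and a = "\<lambda>k. \<bar>\<delta> k\<bar>"])
        (use l \<delta> \<theta> sin_increment_bound in \<open>auto simp: xs_def\<close>)
    moreover have "vnorm xs \<le> 1 * vnorm x"
      by (rule vnorm_mono) (use x in \<open>auto simp: xs_def norm_mult sgn_if\<close>)
    moreover have "0 \<le> sin (pi * l)" using l by (intro sin_ge_zero) auto
    ultimately have "vnorm dc + vnorm ds \<le>
        (1 - cos (pi * l)) * (\<beta> * vnorm x) + sin (pi * l) * (\<beta> * vnorm x)"
      using \<beta> by (smt (verit) mult_left_mono)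
    then show ?thesis
      using vnorm_triangle[of dc L ds] by (simp add: dc_def ds_def kadec_C_def algebra_simps)
  qed
  moreover have "dc + ds \<in> carrier_vec L" by (simp add: dc_def ds_def)
  ultimately show ?thesis by blast
qed

theorem theorem3p4:
  fixes L N r :: nat and u \<delta> u' :: "nat \<Rightarrow> real" and V V' :: "complex mat" and l :: real
  assumes "L \<ge> 1" and "N \<ge> 1"
    and "V = vandermonde L N u"
    and "r = min L N"
    and "mat_rank V = r"
    and "l = sup_norm N \<delta>"
    and "l < 1 / 4"
    and "kadec_C l < singular_value r V / singular_value 1 V"
    and "u' = (\<lambda>k. u k + \<delta> k / real L)"
    and "V' = vandermonde L N u'"
  shows "mat_rank V' = r
    \<and> singular_value r V' \<ge>
        singular_value r V * (1 - singular_value 1 V / singular_value r V * kadec_C l)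
    \<and> singular_value 1 V' \<le> singular_value 1 V * (1 + kadec_C l)"
proof -
  have V: "V \<in> carrier_mat L N" and V': "V' \<in> carrier_mat L N"
    using assms by (auto simp: vandermonde_def)
  have L: "0 < L" using assms(1) by simp
  have r: "1 \<le> r" "r \<le> N" using assms(1,2,4) by auto
  have \<delta>: "\<bar>\<delta> k\<bar> \<le> l" if "k < N" for k
    unfolding assms(6) sup_norm_def using that by (intro Max_ge) auto
  have l: "0 \<le> l" "l \<le> 1/4" using assms(2,7) \<delta>[of 0] by auto
  define \<epsilon> where "\<epsilon> = kadec_C l * singular_value 1 V"
  define X where "X = V' * phase_mat N (\<lambda>k. - pi * \<delta> k)"
  have X: "X \<in> carrier_mat L N" 
    unfolding X_def using V' phase_mat_carrier by (rule mult_carrier_mat)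
  have sX: "singular_value k X = singular_value k V'" for k
    unfolding X_def by (rule singular_value_mult_unitary[OF V' unitary_phase_mat])
  have s1: "0 \<le> singular_value 1 V" using singular_value_nonneg[OF V, of 1] assms(2) by simp
  have le: "vnorm (X *\<^sub>v x) \<le> vnorm (V *\<^sub>v x) + \<epsilon> * vnorm x"
    "vnorm (V *\<^sub>v x) \<le> vnorm (X *\<^sub>v x) + \<epsilon> * vnorm x" if x: "x \<in> carrier_vec N" for x
  proof -
    have bound: "vnorm (vandermonde L N u *\<^sub>v y) \<le> singular_value 1 V * vnorm y"
      if "y \<in> carrier_vec N" for y
      using vnorm_mult_le_singular_value[OF V that] assms(3) by simp
    have "\<exists>d \<in> carrier_vec L. X *\<^sub>v x = V *\<^sub>v x + d \<and> vnorm d \<le> \<epsilon> * vnorm x"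
      using vandermonde_perturbation[where \<delta> = \<delta> and u = u, OF L l \<delta> s1 bound x]
      unfolding X_def \<epsilon>_def assms(3,9,10) .
    then obtain d where d: "d \<in> carrier_vec L" and eq: "X *\<^sub>v x = V *\<^sub>v x + d"
      and nd: "vnorm d \<le> \<epsilon> * vnorm x"
      by blast
    have Vx: "V *\<^sub>v x \<in> carrier_vec L" using V x by simp
    have "V *\<^sub>v x = X *\<^sub>v x + - d" using d Vx unfolding eq by (intro eq_vecI) auto
    then show "vnorm (V *\<^sub>v x) \<le> vnorm (X *\<^sub>v x) + \<epsilon> * vnorm x"
      using vnorm_triangle[of "X *\<^sub>v x" L "- d"] d nd X x by (simp add: vnorm_uminus)
    show "vnorm (X *\<^sub>v x) \<le> vnorm (V *\<^sub>v x) + \<epsilon> * vnorm x"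
      using vnorm_triangle[OF Vx d] nd by (simp add: eq)
  qed
  have upper: "singular_value 1 V' \<le> singular_value 1 V + \<epsilon>"
    using singular_value_perturbation[OF X V _ _ le(1), of 1] assms(2) by (simp add: sX)
  have lower: "singular_value r V \<le> singular_value r V' + \<epsilon>"
    using singular_value_perturbation[OF V X r le(2)] by (simp add: sX)
  have "0 \<le> sin (pi * l)" using l by (intro sin_ge_zero) auto
  then have "0 \<le> kadec_C l" unfolding kadec_C_def using cos_le_one[of "pi * l"] by linarith
  then have "0 < singular_value r V / singular_value 1 V" using assms(8) by linarith
  then have pos: "0 < singular_value 1 V" "0 < singular_value r V"
    using s1 by (auto simp: zero_less_divide_iff)
  then have "\<epsilon> < singular_value r V" using assms(8) by (simp add: \<epsilon>_def pos_less_divide_eq)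
  then have "r \<le> vec_space.rank L V'"
    using rank_ge_if_singular_value_pos[OF V' r] lower by simp
  moreover have "vec_space.rank L V' \<le> r"
    using vec_space.rank_le_nr[OF V'] vec_space.rank_le_nc[OF V'] assms(4) by simp
  ultimately have "mat_rank V' = r" using V' by simp
  then show ?thesis
    using upper lower pos by (simp add: \<epsilon>_def algebra_simps)
qed

end
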